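(* Fix an integer $x\ge0$ and a set $X$ with $|X|=x$. Let $f_x(z),s_x(z),c_x(z),h_x(z)$ be the ordinary generating functions, with $z$ marking $n=|N|$ (i.e. the coefficient of $z^n$ is the count for an $n$-element index set $N$), of the numbers of $S_N$-orbits of, respectively, all $n$-families, strict $n$-families, $n$-coverings, and hypergraphs of $X$. Then, as formal power series, $$f_x(z)=(1-z)^{-2^x},$$ $$s_x(z)=(1-z)f_x(z)=(1-z)^{-(2^x-1)},$$ $$c_x(z)=\sum_{k=0}^{x}(-1)^k\binom xk(1-z)^{-2^{x-k}},$$ $$h_x(z)=(1-z)c_x(z)=\sum_{k=0}^{x}(-1)^k\binom xk(1-z)^{-(2^{x-k}-1)}.$$
   Context: An $n$-family of subsets of $X$ is a tuple $F=(F_i)_{i\in N}$ with $F_i\subseteq X$, $|N|=n$. It is strict if $F_i\neq\varnothing$ for all $i$; an $n$-covering if $\bigcup_{i\in N}F_i=X$; a hypergraph if it is a strict covering. The symmetric group $S_N$ acts by $\pi\cdot(F_i)_{i\in N}=(F_{\pi^{-1}(i)})_{i\in N}$. *)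

theory Defs
  imports
    "HOL-Algebra.Group_Action"
    "HOL-Computational_Algebra.Formal_Power_Series"
begin

text \<open>
  A family indexed by \<open>N\<close> is a function that is \<^const>\<open>undefined\<close> outside \<open>N\<close>, so that distinct
  functions are distinct families; there is exactly one family with empty index set.
\<close>

definition families :: "'i set \<Rightarrow> 'a set \<Rightarrow> ('i \<Rightarrow> 'a set) set" where
  "families N X = (N \<rightarrow>\<^sub>E Pow X)"

definition strict_families :: "'i set \<Rightarrow> 'a set \<Rightarrow> ('i \<Rightarrow> 'a set) set" where
  "strict_families N X = {F \<in> families N X. \<forall>i\<in>N. F i \<noteq> {}}"

definition coverings :: "'i set \<Rightarrow> 'a set \<Rightarrow> ('i \<Rightarrow> 'a set) set" where
  "coverings N X = {F \<in> families N X. (\<Union>i\<in>N. F i) = X}"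

definition hypergraphs :: "'i set \<Rightarrow> 'a set \<Rightarrow> ('i \<Rightarrow> 'a set) set" where
  "hypergraphs N X = strict_families N X \<inter> coverings N X"

text \<open>
  \<^term>\<open>BijGroup N\<close> is the symmetric group of \<open>N\<close>.  The action is given on an
  invariant set \<open>E\<close> of families, as \<^locale>\<open>group_action\<close> expects functions that are
  \<^const>\<open>undefined\<close> outside \<open>E\<close>.
\<close>

definition reindex :: "'i set \<Rightarrow> ('i \<Rightarrow> 'a set) set \<Rightarrow> ('i \<Rightarrow> 'i) \<Rightarrow> ('i \<Rightarrow> 'a set) \<Rightarrow> ('i \<Rightarrow> 'a set)"
  where "reindex N E \<pi> = (\<lambda>F\<in>E. \<lambda>i\<in>N. F (inv_into N \<pi> i))"

definition num_orbits :: "'i set \<Rightarrow> ('i \<Rightarrow> 'a set) set \<Rightarrow> nat" where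
  "num_orbits N E = card (orbits (BijGroup N) E (reindex N E))"

text \<open>
  The argument \<open>I\<close> supplies the index sets: \<open>I n\<close> is meant to have \<open>n\<close> elements.  The coefficients
  are taken in \<^typ>\<open>rat\<close> because the inverse of a power series needs a coefficient type with
  inverses.
\<close>

definition orbit_gf ::
  "('i set \<Rightarrow> 'a set \<Rightarrow> ('i \<Rightarrow> 'a set) set) \<Rightarrow> (nat \<Rightarrow> 'i set) \<Rightarrow> 'a set \<Rightarrow> rat fps" where
  "orbit_gf C I X = Abs_fps (\<lambda>n. of_nat (num_orbits (I n) (C (I n) X)))"

lemma group_action_reindex:
  assumes ext: "\<And>F. F \<in> E \<Longrightarrow> F \<in> extensional N"
    and inv: "\<And>F \<pi>. F \<in> E \<Longrightarrow> \<pi> \<in> Bij N \<Longrightarrow> (\<lambda>i\<in>N. F (\<pi> i)) \<in> E"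
  shows "group_action (BijGroup N) E (reindex N E)"
proof -
  have mem: "reindex N E \<pi> F \<in> E" if "\<pi> \<in> Bij N" "F \<in> E" for \<pi> F
  proof -
    have "(\<lambda>i\<in>N. F ((\<lambda>i\<in>N. inv_into N \<pi> i) i)) \<in> E"
      using inv restrict_inv_into_Bij that by blast
    moreover have "(\<lambda>i\<in>N. F ((\<lambda>i\<in>N. inv_into N \<pi> i) i)) = (\<lambda>i\<in>N. F (inv_into N \<pi> i))"
      by (rule restrict_ext) simp
    ultimately show ?thesis using that by (simp add: reindex_def)
  qed
  have bijN: "bij_betw \<pi> N N" if "\<pi> \<in> Bij N" for \<pi>
    using that by (simp add: Bij_def)
  have inj: "inj_on (reindex N E \<pi>) E" if p: "\<pi> \<in> Bij N" for \<pi>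
  proof (rule inj_onI)
    fix F G assume FG: "F \<in> E" "G \<in> E" "reindex N E \<pi> F = reindex N E \<pi> G"
    show "F = G"
    proof (rule extensionalityI[OF ext[OF FG(1)] ext[OF FG(2)]])
      fix i assume i: "i \<in> N"
      have "reindex N E \<pi> F (\<pi> i) = reindex N E \<pi> G (\<pi> i)" using FG by simp
      moreover have "\<pi> i \<in> N" "inv_into N \<pi> (\<pi> i) = i"
        using bijN[OF p] i by (auto simp: bij_betw_def)
      ultimately show "F i = G i" using FG by (simp add: reindex_def)
    qed
  qed
  have surj: "E \<subseteq> reindex N E \<pi> ` E" if p: "\<pi> \<in> Bij N" for \<pi>
  proof
    fix F assume F: "F \<in> E"
    have "(\<lambda>i\<in>N. F (\<pi> i)) \<in> E" using inv F p by blast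
    moreover have "reindex N E \<pi> (\<lambda>i\<in>N. F (\<pi> i)) = F"
    proof (rule extensionalityI[OF _ ext[OF F]])
      show "reindex N E \<pi> (\<lambda>i\<in>N. F (\<pi> i)) \<in> extensional N"
        using ext[OF mem[OF p inv[OF F p]]] .
      fix i assume i: "i \<in> N"
      then show "reindex N E \<pi> (\<lambda>i\<in>N. F (\<pi> i)) i = F i"
        using bijN[OF p] inv[OF F p]
        by (auto simp: reindex_def bij_betw_def inv_into_into f_inv_into_f)
    qed
    ultimately show "F \<in> reindex N E \<pi> ` E" by force
  qed
  have Bij: "reindex N E \<pi> \<in> Bij E" if p: "\<pi> \<in> Bij N" for \<pi>
    using inj[OF p] surj[OF p] mem[OF p] by (auto simp: Bij_def bij_betw_def reindex_def)
  have mult: "reindex N E (compose N \<pi> \<sigma>) = compose E (reindex N E \<pi>) (reindex N E \<sigma>)"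
    if p: "\<pi> \<in> Bij N" and q: "\<sigma> \<in> Bij N" for \<pi> \<sigma>
  proof (rule extensionalityI[of _ E])
    fix F assume F: "F \<in> E"
    have pq: "compose N \<pi> \<sigma> \<in> Bij N" using p q by (rule compose_Bij)
    have "inv_into N (compose N \<pi> \<sigma>) i = inv_into N \<sigma> (inv_into N \<pi> i)" if i: "i \<in> N" for i
    proof (rule inv_into_f_eq)
      show "inj_on (compose N \<pi> \<sigma>) N" using bijN[OF pq] by (simp add: bij_betw_def)
      have a: "inv_into N \<pi> i \<in> N" using bijN[OF p] i by (simp add: bij_betw_def inv_into_into)
      then show b: "inv_into N \<sigma> (inv_into N \<pi> i) \<in> N"
        using bijN[OF q] by (simp add: bij_betw_def inv_into_into)
      show "compose N \<pi> \<sigma> (inv_into N \<sigma> (inv_into N \<pi> i)) = i"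
        using a b i bijN[OF p] bijN[OF q] by (simp add: compose_def bij_betw_def f_inv_into_f)
    qed
    moreover have "inv_into N \<pi> i \<in> N" if "i \<in> N" for i
      using bijN[OF p] that by (simp add: bij_betw_def inv_into_into)
    ultimately show "reindex N E (compose N \<pi> \<sigma>) F = compose E (reindex N E \<pi>) (reindex N E \<sigma>) F"
      using F mem[OF q F] by (auto simp: reindex_def compose_def intro!: restrict_ext)
  qed (simp_all add: reindex_def compose_def)
  have "reindex N E \<in> hom (BijGroup N) (BijGroup E)"
    by (rule homI) (simp_all add: BijGroup_def Bij mult compose_Bij)
  then show ?thesis
    by (simp add: group_action_def group_hom_def group_hom_axioms_def group_BijGroup)
qed

lemma group_action_families:
  "group_action (BijGroup N) (families N X) (reindex N (families N X))"
  "group_action (BijGroup N) (strict_families N X) (reindex N (strict_families N X))"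
  "group_action (BijGroup N) (coverings N X) (reindex N (coverings N X))"
  "group_action (BijGroup N) (hypergraphs N X) (reindex N (hypergraphs N X))"
proof -
  have fam: "(\<lambda>i\<in>N. F (\<pi> i)) \<in> families N X" if "F \<in> families N X" "\<pi> \<in> Bij N" for F \<pi>
    using that by (auto simp: families_def PiE_iff dest!: Bij_imp_funcset)
  have str: "(\<lambda>i\<in>N. F (\<pi> i)) \<in> strict_families N X" if "F \<in> strict_families N X" "\<pi> \<in> Bij N" for F \<pi>
    using that fam by (auto simp: strict_families_def dest!: Bij_imp_funcset)
  have cov: "(\<lambda>i\<in>N. F (\<pi> i)) \<in> coverings N X" if "F \<in> coverings N X" "\<pi> \<in> Bij N" for F \<pi>
  proof -
    have "\<pi> ` N = N" using that by (simp add: Bij_def bij_betw_def)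
    then have "(\<Union>i\<in>N. F (\<pi> i)) = (\<Union>i\<in>N. F i)" by (metis image_image)
    then show ?thesis using that fam by (simp add: coverings_def)
  qed
  show "group_action (BijGroup N) (families N X) (reindex N (families N X))"
    by (rule group_action_reindex) (use fam in \<open>auto simp: families_def PiE_iff\<close>)
  show "group_action (BijGroup N) (strict_families N X) (reindex N (strict_families N X))"
    by (rule group_action_reindex) (use str in \<open>auto simp: strict_families_def families_def PiE_iff\<close>)
  show "group_action (BijGroup N) (coverings N X) (reindex N (coverings N X))"
    by (rule group_action_reindex) (use cov in \<open>auto simp: coverings_def families_def PiE_iff\<close>)
  show "group_action (BijGroup N) (hypergraphs N X) (reindex N (hypergraphs N X))"
    by (rule group_action_reindex)
      (use str cov in \<open>auto simp: hypergraphs_def coverings_def families_def PiE_iff\<close>)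
qed

end

theory Submission
  imports Defs "HOL-Combinatorics.Permutations"
begin

text \<open>
  Up to reindexing, a family is the multiset of its members: permuting the indices does not change
  this multiset, and two families with the same multiset differ by a permutation of the indices.
  All four classes are cut out of the functions \<open>N \<rightarrow> Pow X\<close> by conditions on the multiset of
  members, so their orbits of index size \<open>n\<close> correspond to the multisets of size \<open>n\<close> over \<open>Pow X\<close>
  with the given property (\<open>num_orbits_eq_card_multisets\<close>).

  Multisets have a simple generating function.  Suppose that adding copies of an element \<open>a\<close> does
  not affect whether a multiset is counted.  A counted multiset that contains \<open>a\<close> becomes one of
  size smaller by one when a copy of \<open>a\<close> is removed, and so the multisets without \<open>a\<close> are counted by
  \<open>1 - z\<close> times the full series (\<open>multiset_gf_remove\<close>).  This fact is used twice.  Removing the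
  elements of a ground set \<open>A\<close> one by one gives \<open>(1 - z) ^ (- card A)\<close> for all multisets over
  \<open>A\<close>, which with \<open>A = Pow X\<close> is the formula for families.  Removing \<open>a = {}\<close>, which is irrelevant
  to being a covering, gives the factor \<open>1 - z\<close> between families and strict families and between
  coverings and hypergraphs.

  Finally, every family of subsets of \<open>X\<close> covers exactly one \<open>T \<subseteq> X\<close>, namely its union.  So the
  series for families is the sum over \<open>T \<subseteq> X\<close> of the series for coverings of \<open>T\<close>, and Moebius
  inversion on the lattice of subsets expresses coverings through families.
\<close>

section \<open>Orbits of families as multisets\<close>

abbreviation members :: "'i set \<Rightarrow> ('i \<Rightarrow> 'b) \<Rightarrow> 'b multiset" where
  "members N F \<equiv> image_mset F (mset_set N)"

lemma members_reindex:
  assumes "\<pi> \<in> Bij N"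
  shows "members N (\<lambda>i\<in>N. F (inv_into N \<pi> i)) = members N F"
proof -
  have bij: "bij_betw (inv_into N \<pi>) N N"
    using assms by (simp add: Bij_def bij_betw_inv_into)
  have "members N (\<lambda>i\<in>N. F (inv_into N \<pi> i)) = members N (F \<circ> inv_into N \<pi>)"
    by (cases "finite N") (auto intro!: image_mset_cong)
  also have "\<dots> = image_mset F (image_mset (inv_into N \<pi>) (mset_set N))"
    by (simp add: image_mset.compositionality)
  also have "image_mset (inv_into N \<pi>) (mset_set N) = mset_set N"
    using bij by (simp add: bij_betw_def image_mset_mset_set)
  finally show ?thesis .
qed

text \<open>
  Equal multisets give, for each value, equally many indices in \<open>F\<close> and in \<open>G\<close> that take it; matching
  these up is a permutation that carries \<open>F\<close> to \<open>G\<close>.  Extensionality of \<open>G\<close> makes the two sides agree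
  outside \<open>N\<close> as well.
\<close>

lemma same_members_imp_reindex:
  assumes "finite N" "members N F = members N G" "G \<in> extensional N"
  obtains \<pi> where "\<pi> \<in> Bij N" "G = (\<lambda>i\<in>N. F (inv_into N \<pi> i))"
proof -
  obtain p where p: "p permutes N" and FG: "\<forall>i\<in>N. F i = G (p i)"
    using image_mset_eq_implies_permutes[OF assms(1,2)] by blast
  define \<pi> where "\<pi> = restrict p N"
  have bij: "bij_betw \<pi> N N"
    using permutes_imp_bij[OF p] by (simp add: \<pi>_def cong: bij_betw_cong)
  have "G i = F (inv_into N \<pi> i)" if "i \<in> N" for i
  proof -
    have "inv_into N \<pi> i \<in> N" "\<pi> (inv_into N \<pi> i) = i"
      using bij that by (simp_all add: bij_betw_def inv_into_into f_inv_into_f)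
    then show ?thesis using FG by (simp add: \<pi>_def)
  qed
  then have "G = (\<lambda>i\<in>N. F (inv_into N \<pi> i))"
    using assms(3) by (auto intro!: extensionalityI[of _ N])
  then show thesis using that[of \<pi>] bij by (simp add: Bij_def \<pi>_def)
qed

lemma orbit_eq_same_members:
  assumes "finite N" and E: "E = {F \<in> N \<rightarrow>\<^sub>E A. P (members N F)}" and F: "F \<in> E"
  shows "orbit (BijGroup N) (reindex N E) F = {G \<in> E. members N G = members N F}"
proof (intro equalityI subsetI)
  fix G assume "G \<in> orbit (BijGroup N) (reindex N E) F"
  then obtain \<pi> where \<pi>: "\<pi> \<in> Bij N" and G: "G = (\<lambda>i\<in>N. F (inv_into N \<pi> i))"
    using F by (auto simp: orbit_def BijGroup_def reindex_def)
  have "inv_into N \<pi> i \<in> N" if "i \<in> N" for i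
    using \<pi> that by (simp add: Bij_def bij_betw_def inv_into_into)
  then have "G \<in> N \<rightarrow>\<^sub>E A" using F E G by (auto simp: PiE_iff)
  then show "G \<in> {G \<in> E. members N G = members N F}"
    using F E G members_reindex[OF \<pi>, of F] by auto
next
  fix G assume G: "G \<in> {G \<in> E. members N G = members N F}"
  then have "G \<in> extensional N" using E by (auto simp: PiE_iff)
  then obtain \<pi> where "\<pi> \<in> Bij N" "G = (\<lambda>i\<in>N. F (inv_into N \<pi> i))"
    using same_members_imp_reindex[OF assms(1), of F G] G by auto
  then show "G \<in> orbit (BijGroup N) (reindex N E) F"
    using F by (auto simp: orbit_def BijGroup_def reindex_def)
qed

lemma ex_family_with_members:
  assumes "finite N" "size M = card N"
  shows "\<exists>F\<in>extensional N. members N F = M"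
proof -
  obtain xs where xs: "mset xs = M" using ex_mset by blast
  obtain h where h: "bij_betw h N {0..<card N}"
    using ex_bij_betw_finite_nat[OF assms(1)] by blast
  have len: "length xs = card N" using xs assms(2) by auto
  have "members N (\<lambda>i\<in>N. xs ! h i) = image_mset (\<lambda>k. xs ! k) (image_mset h (mset_set N))"
    using assms(1) by (auto simp: image_mset.compositionality intro!: image_mset_cong)
  also have "image_mset h (mset_set N) = mset_set {0..<length xs}"
    using h len by (simp add: bij_betw_def image_mset_mset_set)
  also have "image_mset (\<lambda>k. xs ! k) (mset_set {0..<length xs}) = mset (map (\<lambda>k. xs ! k) [0..<length xs])"
    by (simp del: map_nth)
  also have "\<dots> = M" by (simp only: map_nth xs)
  finally show ?thesis using restrict_extensional by blast
qed

text \<open>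
  The orbits are the nonempty fibres of \<open>members N\<close> on \<open>E\<close>, so they can be counted by the values
  of this map.  Every multiset of the right size is a value because its elements can be listed
  along the indices.
\<close>

lemma num_orbits_eq_card_multisets:
  assumes "finite N" and E: "E = {F \<in> N \<rightarrow>\<^sub>E A. P (members N F)}"
  shows "num_orbits N E = card {M \<in> multisets_of_size A (card N). P M}"
proof -
  let ?fibre = "\<lambda>M. {G \<in> E. members N G = M}"
  have "members N ` E = {M \<in> multisets_of_size A (card N). P M}"
  proof (intro equalityI subsetI)
    fix M assume "M \<in> members N ` E"
    then show "M \<in> {M \<in> multisets_of_size A (card N). P M}"
      using assms by (auto simp: multisets_of_size_def)
  next
    fix M assume M: "M \<in> {M \<in> multisets_of_size A (card N). P M}"
    then obtain F where F: "F \<in> extensional N" "members N F = M"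
      using ex_family_with_members[OF assms(1), of M] by (auto simp: multisets_of_size_def)
    have "F ` N = set_mset M" using F(2) assms(1) by auto
    then have "F \<in> E" using M F E by (auto simp: multisets_of_size_def PiE_iff)
    then show "M \<in> members N ` E" using F(2) by blast
  qed
  moreover have "orbits (BijGroup N) E (reindex N E) = ?fibre ` members N ` E"
    using orbit_eq_same_members[OF assms] unfolding orbits_def by (auto simp: image_iff)
  moreover have "inj_on ?fibre (members N ` E)"
    by (rule inj_onI) blast
  ultimately show ?thesis unfolding num_orbits_def by (simp add: card_image)
qed

section \<open>Generating functions of multisets\<close>

definition multiset_gf :: "'b set \<Rightarrow> ('b multiset \<Rightarrow> bool) \<Rightarrow> rat fps" where
  "multiset_gf A P = Abs_fps (\<lambda>n. of_nat (card {M \<in> multisets_of_size A n. P M}))"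

text \<open>
  In size \<open>m + 1\<close>, the counted multisets over \<open>A\<close> either avoid \<open>a\<close> or arise uniquely by adding \<open>a\<close> to
  a counted multiset of size \<open>m\<close>.  Multiplication by \<open>1 - z\<close> subtracts the second kind.
\<close>

lemma multiset_gf_remove:
  assumes "finite A" "a \<in> A" and P: "\<And>M. P (add_mset a M) \<longleftrightarrow> P M"
  shows "multiset_gf (A - {a}) P = (1 - fps_X) * multiset_gf A P"
proof (rule fps_ext)
  fix n
  let ?C = "\<lambda>A n. {M \<in> multisets_of_size A n. P M}"
  show "fps_nth (multiset_gf (A - {a}) P) n = fps_nth ((1 - fps_X) * multiset_gf A P) n"
  proof (cases n)
    case 0
    then show ?thesis by (simp add: multiset_gf_def left_diff_distrib)
  next
    case (Suc m)
    have "?C A (Suc m) = ?C (A - {a}) (Suc m) \<union> add_mset a ` ?C A m"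
    proof (intro equalityI subsetI)
      fix M assume M: "M \<in> ?C A (Suc m)"
      show "M \<in> ?C (A - {a}) (Suc m) \<union> add_mset a ` ?C A m"
      proof (cases "a \<in># M")
        case True
        then obtain M' where "M = add_mset a M'" by (blast dest: multi_member_split)
        then show ?thesis using M P by (auto simp: multisets_of_size_def)
      qed (use M in \<open>auto simp: multisets_of_size_def\<close>)
    qed (use assms in \<open>auto simp: multisets_of_size_def\<close>)
    moreover have "?C (A - {a}) (Suc m) \<inter> add_mset a ` ?C A m = {}"
      by (auto simp: multisets_of_size_def)
    moreover have "finite (?C B k)" if "B \<subseteq> A" for B k
      using finite_multisets_of_size[of B k] finite_subset[OF that assms(1)] by simp
    ultimately have "card (?C A (Suc m)) = card (?C (A - {a}) (Suc m)) + card (?C A m)"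
      by (simp add: card_Un_disjoint card_image inj_on_def)
    then show ?thesis using Suc by (simp add: multiset_gf_def left_diff_distrib)
  qed
qed

lemma inverse_one_minus_X: "(1 - fps_X) * inverse (1 - fps_X :: rat fps) = 1"
  by (rule inverse_mult_eq_1') simp

lemma multiset_gf_all:
  assumes "finite A"
  shows "multiset_gf A (\<lambda>_. True) = inverse (1 - fps_X) ^ card A"
  using assms
proof (induction A rule: finite_induct)
  case empty
  have "card (multisets_of_size ({} :: 'a set) n) = (if n = 0 then 1 else 0)" for n
    by simp
  then show ?case by (simp add: multiset_gf_def fps_eq_iff)
next
  case (insert a A)
  let ?f = "\<lambda>A. multiset_gf A (\<lambda>_. True)" and ?i = "inverse (1 - fps_X) :: rat fps"
  have "?f A = (1 - fps_X) * ?f (insert a A)"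
    using multiset_gf_remove[of "insert a A" a "\<lambda>_. True"] insert.hyps by simp
  then have "?i * ?f A = ((1 - fps_X) * ?i) * ?f (insert a A)"
    by (simp only: ac_simps)
  then have "?f (insert a A) = ?i * ?f A"
    by (simp only: inverse_one_minus_X mult_1_left)
  then show ?case using insert by simp
qed

section \<open>Coverings by Moebius inversion\<close>

lemma multiset_gf_sum_over_unions:
  assumes "finite X"
  shows "multiset_gf (Pow X) (\<lambda>_. True) = (\<Sum>T\<in>Pow X. multiset_gf (Pow T) (\<lambda>M. \<Union>(set_mset M) = T))"
proof (rule fps_ext)
  fix n
  let ?C = "\<lambda>T. {M \<in> multisets_of_size (Pow T) n. \<Union>(set_mset M) = T}"
  have "multisets_of_size (Pow X) n = (\<Union>T\<in>Pow X. ?C T)"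
    by (fastforce simp: multisets_of_size_def)
  moreover have "card (\<Union>T\<in>Pow X. ?C T) = (\<Sum>T\<in>Pow X. card (?C T))"
    by (rule card_UN_disjoint)
      (use assms in \<open>auto intro!: finite_multisets_of_size intro: finite_subset\<close>)
  ultimately show "fps_nth (multiset_gf (Pow X) (\<lambda>_. True)) n
      = fps_nth (\<Sum>T\<in>Pow X. multiset_gf (Pow T) (\<lambda>M. \<Union>(set_mset M) = T)) n"
    by (simp add: multiset_gf_def fps_sum_nth)
qed

lemma sum_Pow_by_co_cardinality:
  fixes f :: "nat \<Rightarrow> 'b::comm_semiring_1"
  assumes "finite X"
  shows "(\<Sum>T\<in>Pow X. f (card X - card T)) = (\<Sum>k=0..card X. of_nat (card X choose k) * f k)"
proof -
  have "(\<Sum>T\<in>Pow X. f (card X - card T)) = (\<Sum>T\<in>Pow X. f (card T))"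
    by (rule sum.reindex_bij_witness[of _ "\<lambda>T. X - T" "\<lambda>T. X - T"])
      (use assms in \<open>auto simp: card_Diff_subset finite_subset\<close>)
  also have "\<dots> = (\<Sum>k=0..card X. \<Sum>T | T \<in> Pow X \<and> card T = k. f (card T))"
    by (rule sum.group[symmetric]) (use assms in \<open>auto intro: card_mono\<close>)
  also have "\<dots> = (\<Sum>k=0..card X. of_nat (card X choose k) * f k)"
    using assms by (simp add: n_subsets)
  finally show ?thesis .
qed

text \<open>
  The Moebius coefficient of \<open>T \<subseteq> X\<close> and the series of all multisets over \<open>Pow T\<close> depend only on
  the number \<open>k\<close> of points of \<open>X\<close> outside \<open>T\<close>; grouping by \<open>k\<close> produces the binomial coefficients.
\<close>

lemma multiset_gf_covering:
  assumes "finite X"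
  shows "multiset_gf (Pow X) (\<lambda>M. \<Union>(set_mset M) = X)
    = (\<Sum>k=0..card X. (- 1) ^ k * of_nat (card X choose k)
        * inverse (1 - fps_X) ^ (2 ^ (card X - k)))"
proof -
  let ?i = "inverse (1 - fps_X) :: rat fps"
  let ?f = "\<lambda>k. (- 1) ^ k * ?i ^ (2 ^ (card X - k))"
  have "multiset_gf (Pow X) (\<lambda>M. \<Union>(set_mset M) = X)
      = (\<Sum>T\<in>Pow X. (- 1) ^ (card X - card T) * multiset_gf (Pow T) (\<lambda>_. True))"
    by (rule inclusion_exclusion_mobius) (use multiset_gf_sum_over_unions assms in auto)
  also have "\<dots> = (\<Sum>T\<in>Pow X. ?f (card X - card T))"
    by (rule sum.cong)
      (use assms in \<open>auto simp: multiset_gf_all finite_subset card_Pow card_mono\<close>)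
  also have "\<dots> = (\<Sum>k=0..card X. of_nat (card X choose k) * ?f k)"
    by (rule sum_Pow_by_co_cardinality[OF assms])
  finally show ?thesis by (simp only: ac_simps)
qed

section \<open>The four generating functions\<close>

lemma orbit_gf_eq_multiset_gf:
  assumes "\<And>n. finite (I n)" "\<And>n. card (I n) = n"
    and "\<And>N. finite N \<Longrightarrow> C N X = {F \<in> N \<rightarrow>\<^sub>E A. P (members N F)}"
  shows "orbit_gf C I X = multiset_gf A P"
  unfolding orbit_gf_def multiset_gf_def
  using num_orbits_eq_card_multisets[OF assms(1) assms(3)[OF assms(1)]] assms(2) by simp

text \<open>
  Strictness only restricts the ground set, from \<open>Pow X\<close> to \<open>Pow X - {{}}\<close>, while covering is a
  property of the multiset that ignores the empty set.  This separation is what lets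
  \<open>multiset_gf_remove\<close> compare the classes.
\<close>

lemma classes_by_members:
  assumes "finite N"
  shows "families N X = {F \<in> N \<rightarrow>\<^sub>E Pow X. True}"
    and "strict_families N X = {F \<in> N \<rightarrow>\<^sub>E Pow X - {{}}. True}"
    and "coverings N X = {F \<in> N \<rightarrow>\<^sub>E Pow X. \<Union>(set_mset (members N F)) = X}"
    and "hypergraphs N X = {F \<in> N \<rightarrow>\<^sub>E Pow X - {{}}. \<Union>(set_mset (members N F)) = X}"
proof -
  show "families N X = {F \<in> N \<rightarrow>\<^sub>E Pow X. True}"
    by (simp add: families_def)
  show "coverings N X = {F \<in> N \<rightarrow>\<^sub>E Pow X. \<Union>(set_mset (members N F)) = X}"
    using assms by (simp add: coverings_def families_def)
  have strict: "strict_families N X = N \<rightarrow>\<^sub>E Pow X - {{}}"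
    unfolding strict_families_def families_def PiE_iff set_eq_iff by blast
  then show "strict_families N X = {F \<in> N \<rightarrow>\<^sub>E Pow X - {{}}. True}"
    by simp
  show "hypergraphs N X = {F \<in> N \<rightarrow>\<^sub>E Pow X - {{}}. \<Union>(set_mset (members N F)) = X}"
    using assms strict
    by (auto simp: hypergraphs_def coverings_def strict_families_def families_def simp del: Pow_iff)
qed

text \<open>
  Exponents of integer powers cannot be added freely for arbitrary power series, because not every
  nonzero series is invertible.  But \<open>1 - z\<close> is, and only exponents \<open>\<le> 0\<close> occur (the second is \<open>0\<close> for
  \<open>m = 0\<close>), so the powers of its inverse suffice.
\<close>

lemma one_minus_X_powi:
  "(1 - fps_X :: rat fps) powi (- (2 ^ m)) = inverse (1 - fps_X) ^ (2 ^ m)"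
  "(1 - fps_X :: rat fps) powi (- (2 ^ m - 1)) = (1 - fps_X) * inverse (1 - fps_X) ^ (2 ^ m)"
proof -
  let ?i = "inverse (1 - fps_X) :: rat fps"
  have powi: "(1 - fps_X :: rat fps) powi (- int k) = ?i ^ k" for k
    by (simp add: power_int_def)
  show "(1 - fps_X :: rat fps) powi (- (2 ^ m)) = ?i ^ (2 ^ m)"
    using powi[of "2 ^ m"] by simp
  define k :: nat where "k = 2 ^ m - 1"
  have k: "2 ^ m = Suc k" "int k = 2 ^ m - 1"
    by (simp_all add: k_def of_nat_diff)
  then show "(1 - fps_X :: rat fps) powi (- (2 ^ m - 1)) = (1 - fps_X) * ?i ^ (2 ^ m)"
    using powi[of k] k inverse_one_minus_X by (simp flip: mult.assoc)
qed

theorem theorem13p1: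
  fixes x :: nat and X :: "'a set" and I :: "nat \<Rightarrow> 'i set"
  assumes "finite X" and "card X = x"
    and "\<And>n. finite (I n)" and "\<And>n. card (I n) = n"
  shows "orbit_gf families I X = (1 - fps_X) powi (- (2 ^ x))
    \<and> orbit_gf strict_families I X = (1 - fps_X) * orbit_gf families I X
    \<and> orbit_gf strict_families I X = (1 - fps_X) powi (- (2 ^ x - 1))
    \<and> orbit_gf coverings I X =
        (\<Sum>k=0..x. (- 1) ^ k * of_nat (x choose k) * (1 - fps_X) powi (- (2 ^ (x - k))))
    \<and> orbit_gf hypergraphs I X = (1 - fps_X) * orbit_gf coverings I X
    \<and> orbit_gf hypergraphs I X =
        (\<Sum>k=0..x. (- 1) ^ k * of_nat (x choose k) * (1 - fps_X) powi (- (2 ^ (x - k) - 1)))"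
proof -
  let ?cov = "\<lambda>M. \<Union>(set_mset M) = X"
  note gf = orbit_gf_eq_multiset_gf[where I = I and X = X, OF assms(3,4)]
  have f: "orbit_gf families I X = multiset_gf (Pow X) (\<lambda>_. True)"
    by (rule gf) (rule classes_by_members(1))
  have s: "orbit_gf strict_families I X = multiset_gf (Pow X - {{}}) (\<lambda>_. True)"
    by (rule gf) (rule classes_by_members(2))
  have c: "orbit_gf coverings I X = multiset_gf (Pow X) ?cov"
    by (rule gf) (rule classes_by_members(3))
  have h: "orbit_gf hypergraphs I X = multiset_gf (Pow X - {{}}) ?cov"
    by (rule gf) (rule classes_by_members(4))
  have f': "orbit_gf families I X = (1 - fps_X) powi (- (2 ^ x))"
    using f multiset_gf_all[of "Pow X"] assms(1,2) by (simp add: one_minus_X_powi card_Pow)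
  have s': "orbit_gf strict_families I X = (1 - fps_X) * orbit_gf families I X"
    unfolding f s by (rule multiset_gf_remove) (use assms(1) in auto)
  have s'': "orbit_gf strict_families I X = (1 - fps_X) powi (- (2 ^ x - 1))"
    unfolding s' f' one_minus_X_powi ..
  have c': "orbit_gf coverings I X =
      (\<Sum>k=0..x. (- 1) ^ k * of_nat (x choose k) * (1 - fps_X) powi (- (2 ^ (x - k))))"
    using c multiset_gf_covering[OF assms(1)] assms(2) by (simp add: one_minus_X_powi)
  have h': "orbit_gf hypergraphs I X = (1 - fps_X) * orbit_gf coverings I X"
    unfolding c h by (rule multiset_gf_remove) (use assms(1) in auto)
  have h'': "orbit_gf hypergraphs I X =
      (\<Sum>k=0..x. (- 1) ^ k * of_nat (x choose k) * (1 - fps_X) powi (- (2 ^ (x - k) - 1)))"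
    unfolding h' c' one_minus_X_powi sum_distrib_left by (simp only: ac_simps)
  show ?thesis using f' s' s'' c' h' h'' by blast
qed

end
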